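(* Let $\mathbb{X}$ be a finite or infinite dimensional linear inner product space with inner product $\langle\cdot,\cdot\rangle$ satisfying $\langle\alpha \boldsymbol{a},\beta \boldsymbol{b}\rangle=\overline{\alpha}\beta\langle \boldsymbol{a},\boldsymbol{b}\rangle$ and induced norm $\|\boldsymbol{z}\|=\sqrt{\langle \boldsymbol{z},\boldsymbol{z}\rangle}$, and let $\boldsymbol{y}\in\mathbb{X}$ be a nonzero vector. Let $\{\boldsymbol{x}_m\}_{m=0}^\infty$ and $\{\boldsymbol{g}_i(m)\}_{m=0}^\infty$, $i=1,2,\ldots$, be sequences in $\mathbb{X}$, let $\boldsymbol{s}\in\mathbb{X}$, and let $\alpha_1,\alpha_2,\ldots$ be scalars (some possibly zero), such that $$\lim_{m\to\infty}\frac{\|\boldsymbol{g}_{i+1}(m)\|}{\|\boldsymbol{g}_i(m)\|}=0,\quad i=1,2,\ldots,$$ and $\boldsymbol{x}_m\sim \boldsymbol{s}+\sum_{i=1}^\infty\alpha_i\boldsymbol{g}_i(m)$ as $m\to\infty$, i.e. $$\Big\|\boldsymbol{x}_m-\boldsymbol{s}-\sum_{i=1}^r\alpha_i\boldsymbol{g}_i(m)\Big\|=o(\|\boldsymbol{g}_r(m)\|)\quad\text{as } m\to\infty,\quad\forall\, r\ge1.$$ Assume in addition that $$\lim_{m\to\infty}\frac{\langle \boldsymbol{y},\boldsymbol{g}_i(m+1)\rangle}{\langle \boldsymbol{y},\boldsymbol{g}_i(m)\rangle}=b_i\ne1,\quad i=1,2,\ldots;\qquad b_i\text{ distinct};\quad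 |b_1|>|b_2|>\cdots;\quad \lim_{i\to\infty}b_i=0,$$ and that $$\lim_{m\to\infty}\frac{\boldsymbol{g}_i(m)}{\langle \boldsymbol{y},\Delta\boldsymbol{g}_i(m)\rangle}=\widehat{\boldsymbol{g}}_i\ne\boldsymbol{0},\quad i=1,2,\ldots.$$ Let $k\ge1$ be a fixed integer, and let $f_{n,k}$, $\boldsymbol{s}_{n,k}$, $\widehat{\boldsymbol{h}}_{k,i}$ and $V$ be as defined in the context. Then the following are true. 1. For every $i=1,2,\ldots$, $$\lim_{m\to\infty}\frac{\langle \boldsymbol{y},\Delta\boldsymbol{g}_i(m+1)\rangle}{\langle \boldsymbol{y},\Delta\boldsymbol{g}_i(m)\rangle}=b_i,\qquad \lim_{m\to\infty}\frac{\langle \boldsymbol{y},\Delta\boldsymbol{g}_{i+1}(m)\rangle}{\langle \boldsymbol{y},\Delta\boldsymbol{g}_i(m)\rangle}=0 .$$ 2. There is a positive integer $n_0$ such that $f_{n,k}(\boldsymbol{v})$ exists for all $n\ge n_0$ and for every sequence $\boldsymbol{v}\equiv\{\boldsymbol{v}_m\}_{m=0}^\infty$ in $\mathbb{X}$, $n_0$ being independent of $\boldsymbol{v}$. 3. (a) With $\boldsymbol{g}_i\equiv\{\boldsymbol{g}_i(m)\}_{m=0}^\infty$, we have $f_{n,k}(\boldsymbol{g}_i)=\boldsymbol{0}$ for $i=1,\ldots,k$, while for $i\ge k+1$, as $n\to\infty$, $$\frac{f_{n,k}(\boldsymbol{g}_i)}{\langle \boldsymbol{y},\Delta\boldsymbol{g}_i(n)\rangle}\sim\frac{\widehat{\boldsymbol{h}}_{k,i}}{V(b_1,\ldots,b_k)}\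 \text{ if }\widehat{\boldsymbol{h}}_{k,i}\ne\boldsymbol{0},\qquad \frac{f_{n,k}(\boldsymbol{g}_i)}{\langle \boldsymbol{y},\Delta\boldsymbol{g}_i(n)\rangle}=o(1)\ \text{ if }\widehat{\boldsymbol{h}}_{k,i}=\boldsymbol{0},$$ and also $$\|f_{n,k}(\boldsymbol{g}_i)\|\sim C_{k,i}\|\boldsymbol{g}_i(n)\|\ \text{ if }\widehat{\boldsymbol{h}}_{k,i}\ne\boldsymbol{0},\qquad \|f_{n,k}(\boldsymbol{g}_i)\|=o(\|\boldsymbol{g}_i(n)\|)\ \text{ if }\widehat{\boldsymbol{h}}_{k,i}=\boldsymbol{0},$$ where $$C_{k,i}=\frac{1}{|V(b_1,\ldots,b_k)|}\,\frac{\|\widehat{\boldsymbol{h}}_{k,i}\|}{\|\widehat{\boldsymbol{g}}_i\|}.$$ (b) In addition, $\{f_{n,k}(\boldsymbol{g}_i)\}_{i=k+1}^\infty$ is an asymptotic scale as $n\to\infty$ in the following generalized sense: $$\lim_{n\to\infty}\frac{\|f_{n,k}(\boldsymbol{g}_{i+1})\|}{\|\boldsymbol{g}_i(n)\|}=0,\quad i\ge k+1.$$ 4. $\boldsymbol{s}_{n,k}$ has the generalized asymptotic expansion $\boldsymbol{s}_{n,k}\sim\boldsymbol{s}+\sum_{i=k+1}^\infty\alpha_if_{n,k}(\boldsymbol{g}_i)$ as $n\to\infty$ with respect to the asymptotic scale $\{\boldsymbol{g}_i(n)\}_{i=1}^\infty$, in the sense that $$\boldsymbol{s}_{n,k}-\boldsymbol{s}-\sum_{i=k+1}^r\alpha_if_{n,k}(\boldsymbol{g}_i)=o(\boldsymbol{g}_r(n))\quad\text{as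 } n\to\infty,\quad\forall\, r\ge k+1.$$ We also have, for $r\geq k+1$, $$\boldsymbol{s}_{n,k}-\boldsymbol{s}-\sum_{i=k+1}^r\alpha_if_{n,k}(\boldsymbol{g}_i)=o(f_{n,k}(\boldsymbol{g}_r))\quad\text{as } n\to\infty,\quad\text{if }\widehat{\boldsymbol{h}}_{k,r}\ne\boldsymbol{0}.$$ 5. Let $\alpha_{k+\mu}$ be the first nonzero $\alpha_{k+i}$ with $i\ge1$. Then: (a) $\boldsymbol{s}_{n,k}-\boldsymbol{s}=O(\boldsymbol{g}_{k+\mu}(n))$ as $n\to\infty$, and, therefore, also $$\boldsymbol{s}_{n,k+j}-\boldsymbol{s}=O(\boldsymbol{g}_{k+\mu}(n))\quad\text{as } n\to\infty,\quad j=0,1,\ldots,k+\mu-1.$$ (b) We also have $$\boldsymbol{s}_{n,k}-\boldsymbol{s}\sim\alpha_{k+\mu}f_{n,k}(\boldsymbol{g}_{k+\mu})\quad\text{as } n\to\infty,\quad\text{if }\widehat{\boldsymbol{h}}_{k,k+\mu}\ne\boldsymbol{0}.$$ As a result, provided $\widehat{\boldsymbol{h}}_{k+j,k+\mu}\ne\boldsymbol{0}$ for $j=0,1,\ldots,\mu-1$, we also have $$\boldsymbol{s}_{n,k+j}-\boldsymbol{s}\sim\alpha_{k+\mu}f_{n,k+j}(\boldsymbol{g}_{k+\mu})\quad\text{as } n\to\infty,\quad j=0,1,\ldots,\mu-1,$$ which also implies $$\|\boldsymbol{s}_{n,k+j}-\boldsymbol{s}\|\sim|\alpha_{k+\mu}|\,C_{k+j,k+\mu}\,\|\boldsymbol{g}_{k+\mu}(n)\|\quad\text{as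 } n\to\infty,\quad j=0,1,\ldots,\mu-1.$$ (c) If $\alpha_k\ne0$ and $\widehat{\boldsymbol{h}}_{k-1,k}\ne\boldsymbol{0}$, then $$\frac{\|\boldsymbol{s}_{n,k+j}-\boldsymbol{s}\|}{\|\boldsymbol{s}_{n,k-1}-\boldsymbol{s}\|}=O\bigg(\frac{\|\boldsymbol{g}_{k+\mu}(n)\|}{\|\boldsymbol{g}_k(n)\|}\bigg)=o(1)\quad\text{as } n\to\infty,\quad j=0,1,\ldots,k+\mu-1.$$
   Context: Notation: $\Delta\boldsymbol{x}_m=\boldsymbol{x}_{m+1}-\boldsymbol{x}_m$ and $\Delta\boldsymbol{g}_i(m)=\boldsymbol{g}_i(m+1)-\boldsymbol{g}_i(m)$ (and similarly for any vector sequence). For a vector sequence $\boldsymbol{v}\equiv\{\boldsymbol{v}_m\}_{m=0}^\infty$ in $\mathbb{X}$ and integers $n\ge0$, $k\ge1$, define $$f_{n,k}(\boldsymbol{v})=\frac{N_{n,k}(\boldsymbol{v})}{D_{n,k}},\qquad N_{n,k}(\boldsymbol{v})=\begin{vmatrix}\boldsymbol{v}_n&\langle \boldsymbol{y},\Delta\boldsymbol{v}_n\rangle&\cdots&\langle \boldsymbol{y},\Delta\boldsymbol{v}_{n+k-1}\rangle\\ \boldsymbol{g}_1(n)&\langle \boldsymbol{y},\Delta\boldsymbol{g}_1(n)\rangle&\cdots&\langle \boldsymbol{y},\Delta\boldsymbol{g}_1(n+k-1)\rangle\\ \vdots&\vdots&&\vdots\\ \boldsymbol{g}_k(n)&\langle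 \boldsymbol{y},\Delta\boldsymbol{g}_k(n)\rangle&\cdots&\langle \boldsymbol{y},\Delta\boldsymbol{g}_k(n+k-1)\rangle\end{vmatrix},$$ $$D_{n,k}=\begin{vmatrix}\langle \boldsymbol{y},\Delta\boldsymbol{g}_1(n)\rangle&\cdots&\langle \boldsymbol{y},\Delta\boldsymbol{g}_1(n+k-1)\rangle\\ \vdots&&\vdots\\ \langle \boldsymbol{y},\Delta\boldsymbol{g}_k(n)\rangle&\cdots&\langle \boldsymbol{y},\Delta\boldsymbol{g}_k(n+k-1)\rangle\end{vmatrix}.$$ $f_{n,k}(\boldsymbol{v})$ is said to exist when $D_{n,k}\ne0$. A determinant whose first column consists of vectors (the other entries being scalars) is the vector obtained by cofactor expansion with respect to its first column. The approximations to $\boldsymbol{s}$ are $\boldsymbol{s}_{n,k}=f_{n,k}(\boldsymbol{x})$ with $\boldsymbol{x}\equiv\{\boldsymbol{x}_m\}$; equivalently, when $D_{n,k}\ne0$, $\boldsymbol{s}_{n,k}=\boldsymbol{x}_n-\sum_{i=1}^k\widetilde\alpha_i\boldsymbol{g}_i(n)$, where the $\widetilde\alpha_i$ solve $\sum_{i=1}^k\langle \boldsymbol{y},\Delta\boldsymbol{g}_i(m)\rangle\widetilde\alpha_i=\langle \boldsymbol{y},\Delta\boldsymbol{x}_m\rangle$, $m=n,\ldots,n+k-1$. Also $\boldsymbol{s}_{n,0}=\boldsymbol{x}_n$. For $i\ge k+1$, $$\widehat{\boldsymbol{h}}_{k,i}=\begin{vmatrix}\widehat{\boldsymbol{g}}_i&1&b_i&\cdots&b_i^{k-1}\\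 \widehat{\boldsymbol{g}}_1&1&b_1&\cdots&b_1^{k-1}\\ \vdots&\vdots&\vdots&&\vdots\\ \widehat{\boldsymbol{g}}_k&1&b_k&\cdots&b_k^{k-1}\end{vmatrix},$$ read as $\widehat{\boldsymbol{h}}_{0,i}=\widehat{\boldsymbol{g}}_i$ when $k=0$. $V(c_1,\ldots,c_k)=\det\big(c_i^{\,j-1}\big)_{1\le i,j\le k}=\prod_{1\le i<j\le k}(c_j-c_i)$ is the Vandermonde determinant. Asymptotic conventions: for scalars, $u_n\sim v_n$ means $u_n/v_n\to1$. For vectors $\boldsymbol{u}_n,\boldsymbol{v}_n$: $\boldsymbol{u}_n=o(\boldsymbol{v}_n)$ means $\|\boldsymbol{u}_n\|=o(\|\boldsymbol{v}_n\|)$, $\boldsymbol{u}_n=O(\boldsymbol{v}_n)$ means $\|\boldsymbol{u}_n\|=O(\|\boldsymbol{v}_n\|)$, $\boldsymbol{u}_n=o(1)$ means $\|\boldsymbol{u}_n\|\to0$, and $\boldsymbol{u}_n\sim\boldsymbol{v}_n$ means $\|\boldsymbol{u}_n-\boldsymbol{v}_n\|=o(\|\boldsymbol{v}_n\|)$. Limits of vectors are in the norm of $\mathbb{X}$. Limits and asymptotic statements concern all sufficiently large indices, for which the quantities (in particular the quotients) involved are defined. The identity $f_{n,k}(\boldsymbol{g}_i)=\boldsymbol{0}$ for $i\le k$ is for all $n$ with $D_{n,k}\ne0$. *)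

theory Defs
  imports "HOL-Analysis.Inner_Product" "HOL-Library.Landau_Symbols"
    "Jordan_Normal_Form.Determinant"
begin

text \<open>
  The real and the complex numbers are the only fields of this class: a normed field over the reals
  is one of the two (Gelfand-Mazur), and the last axiom then forces the usual conjugation.
\<close>

class rc_field = real_normed_field + conjugatable_field +
  assumes mult_conjugate_norm: "x * conjugate x = (norm x)\<^sup>2 *\<^sub>R 1"

instance real :: rc_field
  by standard (simp add: power2_eq_square)

instance complex :: rc_field
  by standard (simp add: complex_norm_square[symmetric] scaleR_conv_of_real)

text \<open>
  Conjugate-linear in the first argument and linear in the second one.  The axiom
  \<open>inner_self\<close> says that the norm of the type is the one induced by \<open>ip\<close>; positive
  definiteness follows from it.  No completeness and no bound on the dimension is assumed.
\<close>

locale inner_product_space = vector_space scale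
  for scale :: "'k::rc_field \<Rightarrow> 'v::real_normed_vector \<Rightarrow> 'v" +
  fixes ip :: "'v \<Rightarrow> 'v \<Rightarrow> 'k"
  assumes scale_of_real: "scale (of_real r) u = r *\<^sub>R u"
    and inner_add_left: "ip (u + v) w = ip u w + ip v w"
    and inner_add_right: "ip u (v + w) = ip u v + ip u w"
    and inner_scale: "ip (scale a u) (scale c v) = conjugate a * c * ip u v"
    and inner_commute: "ip u v = conjugate (ip v u)"
    and inner_self: "ip u u = of_real ((norm u)\<^sup>2)"

lemma inner_product_space_real_inner:
  "inner_product_space scaleR (inner :: 'a::real_inner \<Rightarrow> 'a \<Rightarrow> real)"
  by unfold_locales
    (auto simp: algebra_simps inner_add_left inner_add_right power2_norm_eq_inner inner_commute)

lemma inner_product_space_complex: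
  "inner_product_space (*) (\<lambda>u v :: complex. cnj u * v)"
proof unfold_locales
  fix u :: complex
  show "cnj u * u = of_real ((norm u)\<^sup>2)"
    by (metis complex_norm_square mult.commute of_real_power)
qed (auto simp: algebra_simps scaleR_conv_of_real)

definition fdiff :: "(nat \<Rightarrow> 'v::ab_group_add) \<Rightarrow> nat \<Rightarrow> 'v" where
  "fdiff u m = u (Suc m) - u m"

text \<open>
  \<open>vdet scale k u c\<close> is the determinant of order \<open>k + 1\<close> with the vectors
  \<open>u 0, \<dots>, u k\<close> in its first column and the scalar \<open>c i j\<close> in row \<open>i\<close> and column
  \<open>j + 1\<close>, expanded along the first column.  The cofactors of the first column do not depend on
  the entries of that column, which are set to 0.
\<close>

definition vdet ::
  "('k::comm_ring_1 \<Rightarrow> 'v::comm_monoid_add \<Rightarrow> 'v) \<Rightarrow> nat \<Rightarrow> (nat \<Rightarrow> 'v) \<Rightarrow> (nat \<Rightarrow> nat \<Rightarrow> 'k) \<Rightarrow> 'v"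
where
  "vdet scale k u c =
     (\<Sum>i\<le>k. scale (cofactor (mat (Suc k) (Suc k) (\<lambda>(i, j). if j = 0 then 0 else c i (j - 1))) i 0)
               (u i))"

text \<open>
  The sequences \<open>g i\<close> and the numbers \<open>b i\<close> are indexed from \<open>i = 1\<close>; the values at
  \<open>i = 0\<close> play no role.  Hence \<open>g(0 := v)\<close> lists the sequences belonging to the rows of
  the numerator determinant: \<open>v\<close> in row 0 and \<open>g i\<close> in row \<open>i\<close>.
\<close>

definition Nnk ::
  "('k::comm_ring_1 \<Rightarrow> 'v::ab_group_add \<Rightarrow> 'v) \<Rightarrow> ('v \<Rightarrow> 'v \<Rightarrow> 'k) \<Rightarrow> 'v \<Rightarrow> (nat \<Rightarrow> nat \<Rightarrow> 'v) \<Rightarrow>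
     nat \<Rightarrow> nat \<Rightarrow> (nat \<Rightarrow> 'v) \<Rightarrow> 'v"
where
  "Nnk scale ip y g n k v =
     vdet scale k (\<lambda>i. (g(0 := v)) i n) (\<lambda>i j. ip y (fdiff ((g(0 := v)) i) (n + j)))"

definition Dnk ::
  "('v::ab_group_add \<Rightarrow> 'v \<Rightarrow> 'k::comm_ring_1) \<Rightarrow> 'v \<Rightarrow> (nat \<Rightarrow> nat \<Rightarrow> 'v) \<Rightarrow> nat \<Rightarrow> nat \<Rightarrow> 'k"
where
  "Dnk ip y g n k = det (mat k k (\<lambda>(i, j). ip y (fdiff (g (Suc i)) (n + j))))"

text \<open>Meaningful only when \<open>Dnk ip y g n k \<noteq> 0\<close>; this is what ``exists'' means.\<close>

definition fnk ::
  "('k::field \<Rightarrow> 'v::ab_group_add \<Rightarrow> 'v) \<Rightarrow> ('v \<Rightarrow> 'v \<Rightarrow> 'k) \<Rightarrow> 'v \<Rightarrow> (nat \<Rightarrow> nat \<Rightarrow> 'v) \<Rightarrow>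
     nat \<Rightarrow> nat \<Rightarrow> (nat \<Rightarrow> 'v) \<Rightarrow> 'v"
where
  "fnk scale ip y g n k v = scale (1 / Dnk ip y g n k) (Nnk scale ip y g n k v)"

text \<open>Row 0 carries the index \<open>i\<close>, row \<open>p\<close> the index \<open>p\<close> for \<open>1 \<le> p \<le> k\<close>.\<close>

definition hhat ::
  "('k::comm_ring_1 \<Rightarrow> 'v::comm_monoid_add \<Rightarrow> 'v) \<Rightarrow> (nat \<Rightarrow> 'v) \<Rightarrow> (nat \<Rightarrow> 'k) \<Rightarrow> nat \<Rightarrow> nat \<Rightarrow> 'v"
where
  "hhat scale ghat b k i = vdet scale k (ghat(0 := ghat i)) (\<lambda>p j. (b(0 := b i)) p ^ j)"

definition vandermonde :: "(nat \<Rightarrow> 'k::comm_ring_1) \<Rightarrow> nat \<Rightarrow> 'k" where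
  "vandermonde c k = det (mat k k (\<lambda>(i, j). c (Suc i) ^ j))"

text \<open>For \<open>k = 0\<close> the definitions give the values fixed by convention.\<close>

lemma (in vector_space) fnk_0: "fnk scale ip y g n 0 v = v n"
  by (simp add: fnk_def Nnk_def Dnk_def vdet_def cofactor_def mat_delete_def)

lemma (in vector_space) hhat_0: "hhat scale ghat b 0 i = ghat i"
  by (simp add: hhat_def vdet_def cofactor_def mat_delete_def)

definition vec_asymp_equiv ::
  "(nat \<Rightarrow> 'v::real_normed_vector) \<Rightarrow> (nat \<Rightarrow> 'v) \<Rightarrow> bool"
where
  "vec_asymp_equiv u v \<longleftrightarrow> (\<lambda>n. norm (u n - v n)) \<in> o(\<lambda>n. norm (v n))"

end

theory Submission
  imports Defs
begin

text \<open>
  Dividing row 0 of the numerator determinant by \<open>\<delta> n\<close> and row \<open>p \<ge> 1\<close> of both determinants by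
  \<open>\<langle>y, \<Delta>g\<^sub>p(n)\<rangle>\<close> makes all entries converge, because \<open>\<langle>y, \<Delta>g\<^sub>p(n + j)\<rangle> / \<langle>y, \<Delta>g\<^sub>p(n)\<rangle>\<close> tends to
  \<open>b\<^sub>p\<^sup>j\<close>.  The denominator then tends to a Vandermonde determinant with distinct nodes, so it is
  eventually nonzero and \<open>f\<^sub>n\<^sub>,\<^sub>k(v) / \<delta> n\<close> converges for every \<open>v\<close> whose own row converges after
  division by \<open>\<delta> n\<close>.  For \<open>v = g\<^sub>i\<close> this gives the asymptotics of \<open>f\<^sub>n\<^sub>,\<^sub>k(g\<^sub>i)\<close>; for a remainder \<open>v = o(g\<^sub>r)\<close>
  the limiting row 0 vanishes, so \<open>f\<^sub>n\<^sub>,\<^sub>k(v) = o(g\<^sub>r)\<close>.  Since \<open>f\<^sub>n\<^sub>,\<^sub>k\<close> is linear, reproduces constants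
  and annihilates \<open>g\<^sub>1, \<dots>, g\<^sub>k\<close>, applying it to the expansion of \<open>x\<close> yields the remaining claims.
\<close>

subsection \<open>Cofactors and determinants\<close>

text \<open>The scalar coefficients of \<open>vdet\<close>, named so that statements about
  determinants with a vector column reduce to ordinary determinants.\<close>

definition col0_cofactor :: "nat \<Rightarrow> (nat \<Rightarrow> nat \<Rightarrow> 'k::comm_ring_1) \<Rightarrow> nat \<Rightarrow> 'k" where
  "col0_cofactor k c p =
     cofactor (mat (Suc k) (Suc k) (\<lambda>(i, j). if j = 0 then 0 else c i (j - 1))) p 0"

lemma vdet_col0_cofactor: "vdet scale k u c = (\<Sum>p\<le>k. scale (col0_cofactor k c p) (u p))"
  by (simp add: vdet_def col0_cofactor_def)

text \<open>Laplace expansion along the first column: the minors omit that column, so any scalar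
  column \<open>w\<close> may take the place of the vectors.\<close>

lemma sum_mult_col0_cofactor:
  "(\<Sum>p\<le>k. w p * col0_cofactor k c p) =
     det (mat (Suc k) (Suc k) (\<lambda>(i, j). if j = 0 then w i else c i (j - 1)))"
proof -
  define A where "A = mat (Suc k) (Suc k) (\<lambda>(i, j). if j = 0 then w i else c i (j - 1))"
  have "col0_cofactor k c p = cofactor A p 0" if "p \<le> k" for p
    unfolding col0_cofactor_def cofactor_def A_def
    by (intro arg_cong2[where f = "(*)"] arg_cong[where f = det] refl eq_matI)
       (use that in \<open>auto simp: mat_delete_def\<close>)
  moreover have "det A = (\<Sum>p<Suc k. A $$ (p, 0) * cofactor A p 0)"
    by (rule laplace_expansion_column) (auto simp: A_def)
  ultimately show ?thesis
    by (auto simp: A_def lessThan_Suc_atMost intro!: sum.cong)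
qed

text \<open>A multiple of the \<open>p\<close>-th unit vector as first column isolates a single
  cofactor, which lets row scaling and limits of \<open>det\<close> apply to it.\<close>

lemma col0_cofactor_eq_det:
  assumes "p \<le> k"
  shows "a * col0_cofactor k c p =
    det (mat (Suc k) (Suc k) (\<lambda>(i, j). if j = 0 then (if i = p then a else 0) else c i (j - 1)))"
proof -
  have "(\<Sum>q\<le>k. (if q = p then a else 0) * col0_cofactor k c q) = a * col0_cofactor k c p"
    using assms by (subst sum.remove[of _ p]) (auto intro!: sum.neutral)
  then show ?thesis
    by (simp only: sum_mult_col0_cofactor)
qed

lemma col0_cofactor_0: "col0_cofactor k c 0 = det (mat k k (\<lambda>(i, j). c (Suc i) j))"
  unfolding col0_cofactor_def cofactor_def
  by (auto simp: mat_delete_def intro!: arg_cong[where f = det] eq_matI)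

text \<open>For \<open>p\<close> at least 1 the minor still contains row 0, and Laplace expansion
  along it is linear in \<open>r\<close>.\<close>

lemma col0_cofactor_linear_row0:
  assumes "1 \<le> p" "p \<le> k"
  shows "\<exists>K. \<forall>r. col0_cofactor k (c(0 := r)) p = (\<Sum>j<k. r j * K j)"
proof -
  define B where "B r = mat_delete (mat (Suc k) (Suc k)
    (\<lambda>(i, j). if j = 0 then 0 else (c(0 := r)) i (j - 1))) p 0" for r
  have B: "B r \<in> carrier_mat k k" for r
    by (auto simp: B_def mat_delete_def)
  \<comment> \<open>Deleting row 0 removes \<open>r\<close>, so these cofactors can be computed with
    the zero row in its place.\<close>
  have cof: "cofactor (B r) 0 j = cofactor (B (\<lambda>_. 0)) 0 j" if "j < k" for r j
    unfolding cofactor_def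
    by (intro arg_cong2[where f = "(*)"] arg_cong[where f = det] refl eq_matI)
       (use that assms in \<open>auto simp: B_def mat_delete_def\<close>)
  have "col0_cofactor k (c(0 := r)) p =
      (\<Sum>j<k. r j * ((-1) ^ p * cofactor (B (\<lambda>_. 0)) 0 j))" for r
  proof -
    have "col0_cofactor k (c(0 := r)) p = (-1) ^ p * det (B r)"
      by (simp add: col0_cofactor_def cofactor_def B_def)
    also have "det (B r) = (\<Sum>j<k. B r $$ (0, j) * cofactor (B r) 0 j)"
      by (rule laplace_expansion_row[OF B]) (use assms in auto)
    also have "\<dots> = (\<Sum>j<k. r j * cofactor (B (\<lambda>_. 0)) 0 j)"
    proof (rule sum.cong)
      fix j assume "j \<in> {..<k}"
      then have "B r $$ (0, j) = r j"
        using assms by (auto simp: B_def mat_delete_def)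
      then show "B r $$ (0, j) * cofactor (B r) 0 j = r j * cofactor (B (\<lambda>_. 0)) 0 j"
        using cof[of j r] \<open>j \<in> {..<k}\<close> by (simp only: lessThan_iff)
    qed auto
    finally show ?thesis
      by (simp only: sum_distrib_left mult.left_commute)
  qed
  then show ?thesis
    by (intro exI[of _ "\<lambda>j. (-1) ^ p * cofactor (B (\<lambda>_. 0)) 0 j"] allI)
qed

text \<open>The first column consists of vectors, so the cofactors are first determined by testing
  with scalar columns \<open>w\<close> that agree at 0 and \<open>i\<close>: the resulting
  determinants have two equal rows.\<close>

lemma vdet_equal_rows:
  fixes scale :: "'k::field \<Rightarrow> 'v::ab_group_add \<Rightarrow> 'v"
  assumes "vector_space scale" and i: "1 \<le> i" "i \<le> k"
    and "u i = u 0" "c i = c 0"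
  shows "vdet scale k u c = 0"
proof -
  interpret vector_space scale by fact
  have w: "(\<Sum>p\<le>k. w p * col0_cofactor k c p) = 0" if "w i = w 0" for w
  proof -
    have "det (mat (Suc k) (Suc k) (\<lambda>(i, j). if j = 0 then w i else c i (j - 1))) = 0"
      by (rule det_identical_rows[of _ "Suc k" 0 i]) (use assms that in \<open>auto intro!: eq_vecI\<close>)
    then show ?thesis
      by (simp only: sum_mult_col0_cofactor)
  qed
  have other: "col0_cofactor k c p = 0" if "p \<le> k" "p \<noteq> 0" "p \<noteq> i" for p
    using w[of "\<lambda>q. if q = p then 1 else 0"] that
    by (simp add: if_distrib[of "\<lambda>x. x * _"] cong: if_cong)
  \<comment> \<open>Polymorphic in the summands, since it is used for scalars and for
    vectors.\<close>
  have sum_eq: "sum F {..k} = F 0 + F i"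
    if "\<And>p. p \<le> k \<Longrightarrow> p \<noteq> 0 \<Longrightarrow> p \<noteq> i \<Longrightarrow> F p = 0" for F :: "nat \<Rightarrow> 'b::comm_monoid_add"
  proof -
    have "sum F {..k} = sum F {0, i}"
      by (rule sum.mono_neutral_right) (use i that in auto)
    then show ?thesis using i by simp
  qed
  \<comment> \<open>The constant column 1 shows that the two remaining cofactors are
    opposite.\<close>
  have "col0_cofactor k c 0 + col0_cofactor k c i = 0"
    using w[of "\<lambda>_. 1"] other sum_eq[of "col0_cofactor k c"] by simp
  then have "scale (col0_cofactor k c 0 + col0_cofactor k c i) (u 0) = 0"
    by simp
  moreover have "vdet scale k u c =
      scale (col0_cofactor k c 0) (u 0) + scale (col0_cofactor k c i) (u i)"
    unfolding vdet_col0_cofactor by (rule sum_eq) (simp add: other)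
  ultimately show ?thesis
    using assms by (simp add: scale_left_distrib)
qed

section \<open>Row scaling, limits and nonvanishing of determinants\<close>

text \<open>Every term of the Leibniz formula has exactly one factor from each row.\<close>

lemma det_scale_rows:
  fixes A :: "nat \<Rightarrow> nat \<Rightarrow> 'k::comm_ring_1"
  shows "det (mat n n (\<lambda>(i, j). a i * A i j)) = (\<Prod>i<n. a i) * det (mat n n (\<lambda>(i, j). A i j))"
proof -
  have *: "(\<Prod>i = 0..<n. mat n n (\<lambda>(i, j). B i j) $$ (i, p i)) = (\<Prod>i<n. B i (p i))"
    if "p permutes {0..<n}" for p and B :: "nat \<Rightarrow> nat \<Rightarrow> 'k"
    using permutes_in_image[OF that] by (auto simp: atLeast0LessThan intro!: prod.cong)
  show ?thesis
    unfolding det_def'[OF mat_carrier]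
    by (auto simp: * prod.distrib sum_distrib_left algebra_simps atLeast0LessThan intro!: sum.cong)
qed

text \<open>Cofactor \<open>p\<close> collects the factors of all rows except row \<open>p\<close>;
  the missing \<open>a p\<close> comes from the scaled vector \<open>u p\<close>.\<close>

lemma (in vector_space) vdet_scale_rows:
  "vdet scale k (\<lambda>p. scale (a p) (u p)) (\<lambda>p j. a p * c p j) =
     scale (\<Prod>p\<le>k. a p) (vdet scale k u c)"
proof -
  have "a p * col0_cofactor k (\<lambda>p j. a p * c p j) p = (\<Prod>p\<le>k. a p) * col0_cofactor k c p"
    if "p \<le> k" for p
  proof -
    have "a p * col0_cofactor k (\<lambda>p j. a p * c p j) p =
        det (mat (Suc k) (Suc k) (\<lambda>(i, j). a i * (if j = 0 then (if i = p then 1 else 0) else c i (j - 1))))"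
      unfolding col0_cofactor_eq_det[OF that] by (intro arg_cong[where f = det] eq_matI) auto
    also have "\<dots> = (\<Prod>p\<le>k. a p) * (1 * col0_cofactor k c p)"
      unfolding col0_cofactor_eq_det[OF that] det_scale_rows by (simp only: lessThan_Suc_atMost)
    finally show ?thesis by simp
  qed
  then show ?thesis
    by (auto simp: vdet_col0_cofactor scale_sum_right mult.commute intro!: sum.cong)
qed

lemma tendsto_det:
  fixes A :: "'a \<Rightarrow> nat \<Rightarrow> nat \<Rightarrow> 'k::real_normed_field"
  assumes "\<And>i j. i < n \<Longrightarrow> j < n \<Longrightarrow> ((\<lambda>x. A x i j) \<longlongrightarrow> L i j) F"
  shows "((\<lambda>x. det (mat n n (\<lambda>(i, j). A x i j))) \<longlongrightarrow> det (mat n n (\<lambda>(i, j). L i j))) F"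
proof -
  have *: "p i < n" if "p permutes {0..<n}" "i < n" for p i
    using permutes_in_image[OF that(1), of i] that(2) by simp
  show ?thesis
    unfolding det_def'[OF mat_carrier]
    by (intro tendsto_sum tendsto_mult tendsto_const tendsto_prod) (simp add: * assms)
qed

lemma tendsto_col0_cofactor:
  fixes c :: "'a \<Rightarrow> nat \<Rightarrow> nat \<Rightarrow> 'k::real_normed_field"
  assumes "p \<le> k" and "\<And>i j. i \<le> k \<Longrightarrow> j < k \<Longrightarrow> ((\<lambda>x. c x i j) \<longlongrightarrow> L i j) F"
  shows "((\<lambda>x. col0_cofactor k (c x) p) \<longlongrightarrow> col0_cofactor k L p) F"
proof -
  have eq: "col0_cofactor k c p = det (mat (Suc k) (Suc k)
      (\<lambda>(i, j). if j = 0 then (if i = p then 1 else 0) else c i (j - 1)))" for c :: "nat \<Rightarrow> nat \<Rightarrow> 'k"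
    using col0_cofactor_eq_det[OF assms(1), of 1 c] by simp
  show ?thesis
    unfolding eq by (rule tendsto_det) (use assms(2) in auto)
qed

text \<open>A nonzero kernel vector would be the coefficient vector of a nonzero polynomial of
  degree below \<open>k\<close> with \<open>k\<close> distinct roots.\<close>

lemma vandermonde_nonzero:
  fixes c :: "nat \<Rightarrow> 'k::field"
  assumes "inj_on c {1..k}"
  shows "vandermonde c k \<noteq> 0"
proof
  assume "vandermonde c k = 0"
  moreover define M where "M = mat k k (\<lambda>(i, j). c (Suc i) ^ j)"
  ultimately obtain v where v: "v \<in> carrier_vec k" "v \<noteq> 0\<^sub>v k" and Mv: "M *\<^sub>v v = 0\<^sub>v k"
    using det_0_iff_vec_prod_zero_field[of M k] by (auto simp: vandermonde_def M_def)
  define q where "q = (\<Sum>j<k. Polynomial.monom (v $ j) j)"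
  have coeff_q: "coeff q j = (if j < k then v $ j else 0)" for j
    by (simp add: q_def coeff_sum)
  have "q \<noteq> 0"
  proof
    assume "q = 0"
    then have "v $ j = 0" if "j < k" for j
      using coeff_q[of j] that by simp
    then show False using v by (auto intro!: eq_vecI)
  qed
  \<comment> \<open>Excludes dimension 0, so that degree at most \<open>k - 1\<close> means degree
    below \<open>k\<close>.\<close>
  have "k \<noteq> 0" using v by (cases k) auto
  then have "degree q < k"
    using coeff_q by (intro le_less_trans[OF degree_le[of "k - 1"]]) auto
  have "poly q (c i) = 0" if "i \<in> {1..k}" for i
  proof -
    define l where "l = i - 1"
    then have l: "i = Suc l" "l < k" using that by auto
    have "(\<Sum>j<k. c i ^ j * v $ j) = (M *\<^sub>v v) $ l"
      using l v by (auto simp: M_def scalar_prod_def atLeast0LessThan intro!: sum.cong)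
    also have "\<dots> = 0" using l unfolding Mv by simp
    finally have "(\<Sum>j<k. c i ^ j * v $ j) = 0" .
    then show ?thesis
      by (simp add: q_def poly_sum poly_monom mult.commute)
  qed
  then have "card (c ` {1..k}) \<le> card {z. poly q z = 0}"
    by (intro card_mono poly_roots_finite \<open>q \<noteq> 0\<close>) auto
  also have "\<dots> \<le> degree q"
    by (rule card_poly_roots_bound) fact
  finally show False
    using \<open>degree q < k\<close> card_image[OF assms] by simp
qed

subsection \<open>Linearity of the extrapolation operator\<close>

lemma fdiff_add: "fdiff (\<lambda>m. v m + w m) = (\<lambda>m. fdiff v m + fdiff w m)"
  by (simp add: fdiff_def fun_eq_iff)

lemma conjugate_1: "conjugate (1 :: 'k::rc_field) = 1"
  using mult_conjugate_norm[of "1 :: 'k"] by simp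

section \<open>Consequences of the inner product axioms\<close>

context inner_product_space
begin

lemma inner_scale_right: "ip u (scale c v) = c * ip u v"
  using inner_scale[of 1 u c v] by (simp add: conjugate_1)

lemma inner_diff_right: "ip u (v - w) = ip u v - ip u w"
  using inner_add_right[of u "v - w" w] by simp

lemma inner_diff_left: "ip (v - w) u = ip v u - ip w u"
  using inner_add_left[of "v - w" w u] by simp

lemma inner_zero_right: "ip u 0 = 0"
  using inner_diff_right[of u 0 0] by simp

text \<open>The type of vectors is normed only over the reals; homogeneity for scalars of the field
  follows by evaluating \<open>inner_self\<close> at \<open>scale a u\<close>.\<close>

lemma norm_scale: "norm (scale a u) = norm a * norm u"
proof -
  have "of_real ((norm (scale a u))\<^sup>2) = ip (scale a u) (scale a u)"
    by (rule inner_self[symmetric])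
  also have "\<dots> = a * conjugate a * ip u u"
    by (simp add: inner_scale mult.commute)
  also have "\<dots> = of_real ((norm a * norm u)\<^sup>2)"
    by (simp add: mult_conjugate_norm inner_self scaleR_conv_of_real power_mult_distrib)
  finally have "(norm (scale a u))\<^sup>2 = (norm a * norm u)\<^sup>2"
    by (simp only: of_real_eq_iff)
  then show ?thesis
    by (rule power2_eq_imp_eq) simp_all
qed

lemma bounded_bilinear_scale: "bounded_bilinear scale"
proof (rule bounded_bilinear.intro)
  show "\<exists>B. \<forall>a u. norm (scale a u) \<le> norm a * norm u * B"
    by (rule exI[of _ 1]) (simp add: norm_scale)
  show "scale (r *\<^sub>R a) u = r *\<^sub>R scale a u" for r a u
    by (simp add: scaleR_conv_of_real scale_of_real flip: scale_scale)
  show "scale a (r *\<^sub>R u) = r *\<^sub>R scale a u" for r a u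
    by (simp add: mult.commute flip: scale_of_real)
qed (simp_all add: scale_left_distrib scale_right_distrib)

lemmas tendsto_scale = bounded_bilinear.tendsto[OF bounded_bilinear_scale]

text \<open>Nonnegativity of the squared norm of the part of \<open>v\<close> orthogonal to
  \<open>u\<close>.\<close>

lemma cauchy_schwarz: "norm (ip u v) \<le> norm u * norm v"
proof (cases "u = 0")
  case True
  have "ip 0 v = 0"
    using inner_diff_left[of 0 0 v] by simp
  with True show ?thesis by simp
next
  case False
  define a N where "a = ip u v" and "N = (of_real ((norm u)\<^sup>2) :: 'k)"
  \<comment> \<open>The orthogonal part multiplied by \<open>N\<close>, which avoids
    division.\<close>
  define w where "w = scale N v - scale a u"
  have conj_N: "conjugate N = N"
    using inner_commute[of u u] by (simp add: inner_self N_def)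
  have "ip v u = conjugate a"
    unfolding a_def by (rule inner_commute)
  then have "ip w w = N * N * ip v v - N * (a * conjugate a)"
    by (simp add: w_def inner_diff_left inner_diff_right inner_scale conj_N a_def[symmetric]
        inner_self[of u, folded N_def] algebra_simps)
  also have "\<dots> = of_real ((norm u)\<^sup>2 * ((norm u * norm v)\<^sup>2 - (norm a)\<^sup>2))"
    by (simp add: N_def inner_self mult_conjugate_norm scaleR_conv_of_real power2_eq_square algebra_simps)
  finally have "(norm w)\<^sup>2 = (norm u)\<^sup>2 * ((norm u * norm v)\<^sup>2 - (norm a)\<^sup>2)"
    by (simp only: inner_self of_real_eq_iff)
  then have "0 \<le> (norm u)\<^sup>2 * ((norm u * norm v)\<^sup>2 - (norm a)\<^sup>2)"
    by (metis zero_le_power2)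
  moreover have "(norm u)\<^sup>2 > 0"
    using False by simp
  ultimately have "(norm a)\<^sup>2 \<le> (norm u * norm v)\<^sup>2"
    by (simp add: zero_le_mult_iff)
  then show ?thesis
    unfolding a_def by (rule power2_le_imp_le) simp
qed

section \<open>Vector determinants and the linear operator \<open>fnk\<close>\<close>

text \<open>Multiplying the zero row by 0 changes nothing, yet row scaling extracts the factor
  0.\<close>

lemma vdet_zero_row: "u 0 = 0 \<Longrightarrow> c 0 = (\<lambda>_. 0) \<Longrightarrow> vdet scale k u c = 0"
proof -
  assume z: "u 0 = 0" "c 0 = (\<lambda>_. 0)"
  have "vdet scale k (\<lambda>p. scale (if p = 0 then 0 else 1) (u p)) (\<lambda>p j. (if p = 0 then 0 else 1) * c p j) =
      scale (\<Prod>p\<le>k. if p = 0 then 0 else 1) (vdet scale k u c)"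
    by (rule vdet_scale_rows)
  also have "(\<lambda>p. scale (if p = 0 then 0 else 1) (u p)) = u"
    using z by (auto simp: fun_eq_iff)
  also have "(\<lambda>p j. (if p = 0 then 0 else 1) * c p j) = c"
    using z by (auto simp: fun_eq_iff)
  also have "(\<Prod>p\<le>k. if p = 0 then 0 else 1 :: 'k) = 0"
    by (auto simp: prod_zero_iff)
  finally show ?thesis by simp
qed

lemma tendsto_vdet:
  assumes "\<And>i. i \<le> k \<Longrightarrow> ((\<lambda>x. u x i) \<longlongrightarrow> U i) F"
    and "\<And>i j. i \<le> k \<Longrightarrow> j < k \<Longrightarrow> ((\<lambda>x. c x i j) \<longlongrightarrow> L i j) F"
  shows "((\<lambda>x. vdet scale k (u x) (c x)) \<longlongrightarrow> vdet scale k U L) F"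
  unfolding vdet_col0_cofactor
  by (intro tendsto_sum tendsto_scale tendsto_col0_cofactor) (use assms in auto)

text \<open>The scalars \<open>K\<close> do not depend on \<open>v\<close>, which makes \<open>fnk\<close> linear in \<open>v\<close>.\<close>

lemma Nnk_expand:
  "\<exists>K. \<forall>v. Nnk scale ip y g n k v = scale (Dnk ip y g n k) (v n) +
     (\<Sum>p=1..k. scale (\<Sum>j<k. ip y (fdiff v (n + j)) * K p j) (g p n))"
proof -
  define c where "c = (\<lambda>i j. ip y (fdiff (g i) (n + j)))"
  \<comment> \<open>Made vacuous outside \<open>{1..k}\<close> so that one choice function serves
    all \<open>p\<close>.\<close>
  have "\<forall>p. \<exists>K. p \<in> {1..k} \<longrightarrow> (\<forall>r. col0_cofactor k (c(0 := r)) p = (\<Sum>j<k. r j * K j))"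
    using col0_cofactor_linear_row0[of _ k c] by auto
  then obtain K where
    K: "col0_cofactor k (c(0 := r)) p = (\<Sum>j<k. r j * K p j)" if "p \<in> {1..k}" for p r
    by metis
  have "Nnk scale ip y g n k v = scale (Dnk ip y g n k) (v n) +
     (\<Sum>p=1..k. scale (\<Sum>j<k. ip y (fdiff v (n + j)) * K p j) (g p n))" for v
  proof -
    define C where "C = c(0 := \<lambda>j. ip y (fdiff v (n + j)))"
    have "(\<lambda>i j. ip y (fdiff ((g(0 := v)) i) (n + j))) = C"
      by (auto simp: C_def c_def fun_eq_iff)
    then have "Nnk scale ip y g n k v =
        (\<Sum>p=0..k. scale (col0_cofactor k C p) ((g(0 := v)) p n))"
      by (simp only: Nnk_def vdet_col0_cofactor atMost_atLeast0)
    also have "\<dots> = scale (col0_cofactor k C 0) (v n) +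
        (\<Sum>p=1..k. scale (col0_cofactor k C p) ((g(0 := v)) p n))"
      by (simp add: sum.atLeast_Suc_atMost)
    also have "col0_cofactor k C 0 = Dnk ip y g n k"
      by (simp add: col0_cofactor_0 Dnk_def C_def c_def)
    also have "(\<Sum>p=1..k. scale (col0_cofactor k C p) ((g(0 := v)) p n)) =
        (\<Sum>p=1..k. scale (\<Sum>j<k. ip y (fdiff v (n + j)) * K p j) (g p n))"
      by (intro sum.cong) (auto simp: K C_def)
    finally show ?thesis .
  qed
  then show ?thesis by blast
qed

text \<open>The same \<open>K\<close> serves \<open>v\<close>, \<open>w\<close> and their sum. The
  identity holds even where the denominator vanishes, because only the numerator depends on the
  sequence.\<close>

lemma fnk_add:
  "fnk scale ip y g n k (\<lambda>m. v m + w m) = fnk scale ip y g n k v + fnk scale ip y g n k w"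
proof -
  obtain K where K: "\<And>v. Nnk scale ip y g n k v = scale (Dnk ip y g n k) (v n) +
     (\<Sum>p=1..k. scale (\<Sum>j<k. ip y (fdiff v (n + j)) * K p j) (g p n))"
    using Nnk_expand by blast
  show ?thesis
    by (simp add: fnk_def K fdiff_add inner_add_right distrib_right sum.distrib
        scale_left_distrib scale_right_distrib add_ac)
qed

lemma fnk_scale:
  "fnk scale ip y g n k (\<lambda>m. scale a (v m)) = scale a (fnk scale ip y g n k v)"
proof -
  obtain K where K: "\<And>v. Nnk scale ip y g n k v = scale (Dnk ip y g n k) (v n) +
     (\<Sum>p=1..k. scale (\<Sum>j<k. ip y (fdiff v (n + j)) * K p j) (g p n))"
    using Nnk_expand by blast
  have "ip y (fdiff (\<lambda>m. scale a (v m)) i) = a * ip y (fdiff v i)" for i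
    by (simp add: fdiff_def inner_scale_right inner_diff_right right_diff_distrib)
  then show ?thesis
    by (simp add: fnk_def K scale_right_distrib scale_sum_right sum_distrib_left mult_ac)
qed

text \<open>The differences of a constant sequence vanish, so only the term with \<open>Dnk\<close>
  survives in the numerator.\<close>

lemma fnk_const:
  assumes "Dnk ip y g n k \<noteq> 0"
  shows "fnk scale ip y g n k (\<lambda>_. s) = s"
proof -
  obtain K where K: "\<And>v. Nnk scale ip y g n k v = scale (Dnk ip y g n k) (v n) +
     (\<Sum>p=1..k. scale (\<Sum>j<k. ip y (fdiff v (n + j)) * K p j) (g p n))"
    using Nnk_expand by blast
  show ?thesis
    using assms by (simp add: fnk_def K fdiff_def inner_zero_right)
qed

lemma fnk_sum:
  assumes "finite I"
  shows "fnk scale ip y g n k (\<lambda>m. \<Sum>i\<in>I. v i m) = (\<Sum>i\<in>I. fnk scale ip y g n k (v i))"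
  using assms
proof (induction I rule: finite_induct)
  case empty
  show ?case
    using fnk_scale[of y g n k 0 "\<lambda>_. 0"] by simp
next
  case (insert i I)
  then show ?case by (simp add: fnk_add)
qed

text \<open>Rows 0 and \<open>i\<close> of the numerator coincide.\<close>

lemma fnk_g_eq_0:
  assumes "i \<in> {1..k}"
  shows "fnk scale ip y g n k (g i) = 0"
proof -
  have "Nnk scale ip y g n k (g i) = 0"
    unfolding Nnk_def
    by (rule vdet_equal_rows[of _ i]) (use assms vector_space_axioms in \<open>auto\<close>)
  then show ?thesis by (simp add: fnk_def)
qed

text \<open>Apply the operator to \<open>x\<close> written as \<open>s\<close> plus partial sum plus
  remainder: it fixes \<open>s\<close> and annihilates the terms up to \<open>k\<close>. For
  \<open>r\<close> at most \<open>k\<close> the sum on the left is empty.\<close>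

lemma fnk_expansion:
  assumes "Dnk ip y g n k \<noteq> 0"
  shows "fnk scale ip y g n k x - s - (\<Sum>i=k+1..r. scale (\<alpha> i) (fnk scale ip y g n k (g i))) =
    fnk scale ip y g n k (\<lambda>m. x m - s - (\<Sum>i=1..r. scale (\<alpha> i) (g i m)))"
proof -
  let ?f = "fnk scale ip y g n k"
  define e where "e = (\<lambda>m. x m - s - (\<Sum>i=1..r. scale (\<alpha> i) (g i m)))"
  have "x = (\<lambda>m. (s + (\<Sum>i=1..r. scale (\<alpha> i) (g i m))) + e m)"
    by (simp add: e_def fun_eq_iff)
  then have "?f x = ?f (\<lambda>m. (s + (\<Sum>i=1..r. scale (\<alpha> i) (g i m))) + e m)"
    by (rule arg_cong)
  also have "\<dots> = s + (\<Sum>i=1..r. scale (\<alpha> i) (?f (g i))) + ?f e"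
    by (simp add: fnk_add fnk_const[OF assms] fnk_sum fnk_scale)
  also have "(\<Sum>i=1..r. scale (\<alpha> i) (?f (g i))) = (\<Sum>i=k+1..r. scale (\<alpha> i) (?f (g i)))"
    by (rule sum.mono_neutral_right) (auto simp: fnk_g_eq_0)
  finally show ?thesis
    by (simp add: e_def)
qed

end

subsection \<open>Asymptotics\<close>

text \<open>Reverse triangle inequality.\<close>

lemma vec_asymp_equiv_norm:
  assumes "vec_asymp_equiv u v"
  shows "(\<lambda>n. norm (u n)) \<sim>[sequentially] (\<lambda>n. norm (v n))"
proof (rule smallo_imp_asymp_equiv)
  have "(\<lambda>n. norm (u n) - norm (v n)) \<in> O(\<lambda>n. norm (u n - v n))"
    by (rule bigoI[of _ 1]) (simp add: norm_triangle_ineq3)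
  also have "(\<lambda>n. norm (u n - v n)) \<in> o(\<lambda>n. norm (v n))"
    using assms by (simp add: vec_asymp_equiv_def)
  finally show "(\<lambda>n. norm (u n) - norm (v n)) \<in> o(\<lambda>n. norm (v n))" .
qed

lemma vec_asymp_equiv_const:
  assumes "u \<longlonglongrightarrow> L" "L \<noteq> 0"
  shows "vec_asymp_equiv u (\<lambda>_. L)"
proof -
  have "(\<lambda>n. norm (u n - L)) \<longlonglongrightarrow> 0"
    using assms(1) by (simp add: LIM_zero tendsto_norm_zero)
  then show ?thesis
    unfolding vec_asymp_equiv_def using assms(2)
    by (intro smalloI_tendsto) (auto intro!: tendsto_eq_intros)
qed

section \<open>Orders of growth in the asymptotic scale\<close>

text \<open>The hypotheses on the scale alone; the expansion of \<open>x\<close> is added later in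
  \<open>extrapolation\<close>.\<close>

locale extrapolation_scale = inner_product_space scale ip
  for scale :: "'k::rc_field \<Rightarrow> 'v::real_normed_vector \<Rightarrow> 'v" and ip +
  fixes y :: 'v and g :: "nat \<Rightarrow> nat \<Rightarrow> 'v" and ghat :: "nat \<Rightarrow> 'v" and b :: "nat \<Rightarrow> 'k"
  assumes g_ratio: "i \<ge> 1 \<Longrightarrow> (\<lambda>m. norm (g (Suc i) m) / norm (g i m)) \<longlonglongrightarrow> 0"
    and ip_ratio: "i \<ge> 1 \<Longrightarrow> (\<lambda>m. ip y (g i (Suc m)) / ip y (g i m)) \<longlonglongrightarrow> b i"
    and b_ne_1: "i \<ge> 1 \<Longrightarrow> b i \<noteq> 1"
    and b_inj: "inj_on b {1..}"
    and b_decreasing: "i \<ge> 1 \<Longrightarrow> norm (b i) > norm (b (Suc i))"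
    and ghat_lim: "i \<ge> 1 \<Longrightarrow> (\<lambda>m. scale (1 / ip y (fdiff (g i) m)) (g i m)) \<longlonglongrightarrow> ghat i"
    and ghat_nonzero: "i \<ge> 1 \<Longrightarrow> ghat i \<noteq> 0"
begin

abbreviation d :: "nat \<Rightarrow> nat \<Rightarrow> 'k" where
  "d i m \<equiv> ip y (fdiff (g i) m)"

abbreviation f :: "nat \<Rightarrow> nat \<Rightarrow> (nat \<Rightarrow> 'v) \<Rightarrow> 'v" where
  "f \<equiv> fnk scale ip y g"

abbreviation C :: "nat \<Rightarrow> nat \<Rightarrow> real" where
  "C k i \<equiv> 1 / norm (vandermonde b k) * (norm (hhat scale ghat b k i) / norm (ghat i))"

lemma b_nonzero: "i \<ge> 1 \<Longrightarrow> b i \<noteq> 0"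
  using b_decreasing[of i] by auto

text \<open>Since \<open>1 / 0 = 0\<close>, the vector in \<open>ghat_lim\<close> is 0 wherever
  \<open>d i m\<close> vanishes, but its limit is nonzero. The same argument gives
  \<open>ip_nonzero\<close>.\<close>

lemma d_nonzero:
  assumes "i \<ge> 1"
  shows "eventually (\<lambda>m. d i m \<noteq> 0) sequentially"
  using tendsto_imp_eventually_ne[OF ghat_lim ghat_nonzero, OF assms assms]
  by eventually_elim auto

lemma ip_nonzero:
  assumes "i \<ge> 1"
  shows "eventually (\<lambda>m. ip y (g i m) \<noteq> 0) sequentially"
  using tendsto_imp_eventually_ne[OF ip_ratio b_nonzero, OF assms assms]
  by eventually_elim auto

lemma g_nonzero:
  assumes "i \<ge> 1"
  shows "eventually (\<lambda>m. g i m \<noteq> 0) sequentially"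
  using ip_nonzero[OF assms] by eventually_elim (auto simp: inner_zero_right)

lemma norm_g_over_norm_d:
  assumes "i \<ge> 1"
  shows "(\<lambda>m. norm (g i m) / norm (d i m)) \<longlonglongrightarrow> norm (ghat i)"
  using tendsto_norm[OF ghat_lim[OF assms]] by (simp add: norm_scale norm_divide)

text \<open>Lets estimates pass between the vectors \<open>g i\<close> and the scalars
  \<open>d i\<close>.\<close>

lemma norm_g_theta_d:
  assumes "i \<ge> 1"
  shows "(\<lambda>m. norm (g i m)) \<in> \<Theta>(\<lambda>m. norm (d i m))"
  by (rule bigthetaI_tendsto[OF _ norm_g_over_norm_d[OF assms]]) (use ghat_nonzero assms in auto)

text \<open>With \<open>r\<close> the ratio of consecutive inner products, the quotient is
  \<open>r m * (r (Suc m) - 1) / (r m - 1)\<close>; its denominator has the nonzero limit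
  \<open>b i - 1\<close>.\<close>

lemma d_ratio:
  assumes "i \<ge> 1"
  shows "(\<lambda>m. d i (Suc m) / d i m) \<longlonglongrightarrow> b i"
proof -
  define r where "r = (\<lambda>m. ip y (g i (Suc m)) / ip y (g i m))"
  have r: "r \<longlonglongrightarrow> b i"
    unfolding r_def by (rule ip_ratio[OF assms])
  have "(\<lambda>m. r m * (r (Suc m) - 1) / (r m - 1)) \<longlonglongrightarrow> b i * (b i - 1) / (b i - 1)"
    using b_ne_1[OF assms] by (intro tendsto_intros r LIMSEQ_Suc) auto
  moreover have "eventually (\<lambda>m. r m * (r (Suc m) - 1) / (r m - 1) = d i (Suc m) / d i m) sequentially"
    using ip_nonzero[OF assms] eventually_sequentially_Suc[THEN iffD2, OF ip_nonzero[OF assms]]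
  proof eventually_elim
    case (elim m)
    have "r m * (r (Suc m) - 1) = d i (Suc m) / ip y (g i m)"
      using elim by (simp add: r_def fdiff_def inner_diff_right right_diff_distrib diff_divide_distrib)
    moreover have "r m - 1 = d i m / ip y (g i m)"
      using elim by (simp add: r_def fdiff_def inner_diff_right diff_divide_distrib)
    ultimately show ?case
      using elim by simp
  qed
  ultimately show ?thesis
    using b_ne_1[OF assms] by (simp add: Lim_transform_eventually)
qed

text \<open>Telescoping product of \<open>j\<close> consecutive ratios.\<close>

lemma d_shift:
  assumes "i \<ge> 1"
  shows "(\<lambda>m. d i (m + j) / d i m) \<longlonglongrightarrow> b i ^ j"
proof (induction j)
  case 0
  have "eventually (\<lambda>m. 1 = d i (m + 0) / d i m) sequentially"
    using d_nonzero[OF assms] by eventually_elim simp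
  then show ?case
    by (simp add: tendsto_eventually eventually_mono)
next
  case (Suc j)
  have "(\<lambda>m. d i (Suc (m + j)) / d i (m + j) * (d i (m + j) / d i m)) \<longlonglongrightarrow> b i * b i ^ j"
    using LIMSEQ_ignore_initial_segment[OF d_ratio[OF assms], of j] Suc by (intro tendsto_mult) auto
  moreover have "eventually (\<lambda>m. d i (Suc (m + j)) / d i (m + j) * (d i (m + j) / d i m) =
      d i (m + Suc j) / d i m) sequentially"
    \<comment> \<open>The cancelled term is \<open>d i (m + j)\<close>, so nonvanishing is needed
      beyond \<open>m\<close> as well.\<close>
    using eventually_all_ge_at_top[OF d_nonzero[OF assms]] by eventually_elim simp
  ultimately show ?case
    by (simp only: power_Suc) (rule Lim_transform_eventually)
qed

lemma g_smallo:
  assumes "1 \<le> i" "i < l"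
  shows "(\<lambda>m. norm (g l m)) \<in> o(\<lambda>m. norm (g i m))"
proof -
  have *: "(\<lambda>m. norm (g (Suc l) m)) \<in> o(\<lambda>m. norm (g l m))" if "1 \<le> l" for l
    by (rule smalloI_tendsto) (use g_ratio[OF that] g_nonzero[OF that] in auto)
  from \<open>i < l\<close> have "Suc i \<le> l" by simp
  then show ?thesis
  proof (induction l rule: dec_induct)
    case base
    show ?case by (rule *) fact
  next
    case (step l)
    have "(\<lambda>m. norm (g (Suc l) m)) \<in> o(\<lambda>m. norm (g l m))"
      by (rule *) (use step.hyps in auto)
    then show ?case
      using step.IH by (rule landau_o.small_trans)
  qed
qed

lemma d_smallo:
  assumes "1 \<le> i"
  shows "d (Suc i) \<in> o(d i)"
proof -
  have "(\<lambda>m. norm (d (Suc i) m)) \<in> O(\<lambda>m. norm (g (Suc i) m))"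
    using norm_g_theta_d[of "Suc i"] by (auto dest: bigthetaD2 simp: bigomega_iff_bigo)
  also have "(\<lambda>m. norm (g (Suc i) m)) \<in> o(\<lambda>m. norm (g i m))"
    by (rule g_smallo) (use assms in auto)
  also have "(\<lambda>m. norm (g i m)) \<in> O(\<lambda>m. norm (d i m))"
    using norm_g_theta_d[OF assms] by (rule bigthetaD1)
  finally show ?thesis by simp
qed

lemma vandermonde_b_nonzero: "vandermonde b k \<noteq> 0"
  by (rule vandermonde_nonzero) (rule inj_on_subset[OF b_inj], auto)

section \<open>Limits of the extrapolation operator\<close>

text \<open>The normalized row of \<open>g p\<close> tends to the powers of \<open>b p\<close>, by
  \<open>d_shift\<close>.\<close>

lemma Dnk_tendsto:
  "(\<lambda>n. (\<Prod>p=1..k. 1 / d p n) * Dnk ip y g n k) \<longlonglongrightarrow> vandermonde b k"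
proof -
  have "(\<lambda>n. det (mat k k (\<lambda>(i, j). 1 / d (Suc i) n * d (Suc i) (n + j)))) \<longlonglongrightarrow> vandermonde b k"
    unfolding vandermonde_def by (rule tendsto_det) (use d_shift in auto)
  moreover have "(\<Prod>p=1..k. 1 / d p n) = (\<Prod>i<k. 1 / d (Suc i) n)" for n
    by (rule prod.reindex_bij_witness[of _ Suc "\<lambda>p. p - 1"]) auto
  ultimately show ?thesis
    by (simp only: det_scale_rows Dnk_def)
qed

lemma Dnk_nonzero: "eventually (\<lambda>n. Dnk ip y g n k \<noteq> 0) sequentially"
  using tendsto_imp_eventually_ne[OF Dnk_tendsto vandermonde_b_nonzero]
  by eventually_elim auto

text \<open>The normalization \<open>\<delta>\<close> of row 0 stays free, so that both the scale
  sequences and the remainders are covered.\<close>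

lemma fnk_tendsto:
  assumes v: "(\<lambda>n. scale (1 / \<delta> n) (v n)) \<longlonglongrightarrow> L"
    and c: "\<And>j. j < k \<Longrightarrow> (\<lambda>n. ip y (fdiff v (n + j)) / \<delta> n) \<longlonglongrightarrow> c j"
  shows "(\<lambda>n. scale (1 / \<delta> n) (f n k v)) \<longlonglongrightarrow>
    scale (1 / vandermonde b k) (vdet scale k (ghat(0 := L)) (\<lambda>p j. if p = 0 then c j else b p ^ j))"
    (is "_ \<longlonglongrightarrow> scale _ ?W")
proof -
  define P where "P n = (\<Prod>p=1..k. 1 / d p n)" for n
  define a where "a n p = (if p = 0 then 1 / \<delta> n else 1 / d p n)" for n p
  have prod_a: "(\<Prod>p\<le>k. a n p) = 1 / \<delta> n * P n" for n
    by (simp add: atMost_atLeast0 prod.atLeast_Suc_atMost P_def a_def)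
  have "(\<lambda>n. vdet scale k (\<lambda>p. scale (a n p) ((g(0 := v)) p n))
      (\<lambda>p j. a n p * ip y (fdiff ((g(0 := v)) p) (n + j)))) \<longlonglongrightarrow> ?W"
    by (rule tendsto_vdet) (use v c ghat_lim d_shift in \<open>auto simp: a_def\<close>)
  then have N: "(\<lambda>n. scale (1 / \<delta> n * P n) (Nnk scale ip y g n k v)) \<longlonglongrightarrow> ?W"
    by (simp only: vdet_scale_rows prod_a Nnk_def)
  \<comment> \<open>\<open>P n\<close> occurs in numerator and denominator and cancels, leaving
    \<open>1 / \<delta> n\<close>.\<close>
  have "(\<lambda>n. scale (1 / (P n * Dnk ip y g n k)) (scale (1 / \<delta> n * P n) (Nnk scale ip y g n k v)))
      \<longlonglongrightarrow> scale (1 / vandermonde b k) ?W"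
    by (intro tendsto_scale N tendsto_divide tendsto_const vandermonde_b_nonzero)
       (use Dnk_tendsto in \<open>simp add: P_def\<close>)
  moreover have "eventually (\<lambda>n. scale (1 / (P n * Dnk ip y g n k))
      (scale (1 / \<delta> n * P n) (Nnk scale ip y g n k v)) = scale (1 / \<delta> n) (f n k v)) sequentially"
    using tendsto_imp_eventually_ne[OF Dnk_tendsto[of k, folded P_def] vandermonde_b_nonzero]
    by eventually_elim (simp add: fnk_def)
  ultimately show ?thesis
    by (rule Lim_transform_eventually)
qed

text \<open>For \<open>\<delta> = d i\<close> the limiting row 0 is \<open>ghat i\<close> followed
  by the powers of \<open>b i\<close>, which is row 0 of \<open>hhat\<close>.\<close>

lemma fnk_g_tendsto:
  assumes "1 \<le> i"
  shows "(\<lambda>n. scale (1 / d i n) (f n k (g i))) \<longlonglongrightarrow>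
    scale (1 / vandermonde b k) (hhat scale ghat b k i)"
proof -
  have "(\<lambda>p j. (b(0 := b i)) p ^ j) = (\<lambda>p j. if p = 0 then b i ^ j else b p ^ j)"
    by (auto simp: fun_eq_iff)
  then show ?thesis
    unfolding hhat_def using fnk_tendsto[OF ghat_lim d_shift, OF assms assms] by simp
qed

text \<open>Normalized by \<open>d r\<close>, the row of \<open>e\<close> tends to zero:
  Cauchy-Schwarz controls the inner products with \<open>y\<close>, and an index shift costs
  \<open>d r\<close> only a bounded factor.\<close>

lemma fnk_smallo:
  assumes r: "1 \<le> r" and e: "(\<lambda>m. norm (e m)) \<in> o(\<lambda>m. norm (g r m))"
  shows "(\<lambda>n. norm (f n k e)) \<in> o(\<lambda>n. norm (g r n))"
proof -
  have e_d: "(\<lambda>n. norm (e n)) \<in> o(\<lambda>n. norm (d r n))"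
    using e bigthetaD1[OF norm_g_theta_d[OF r]] by (rule landau_o.small_big_trans)
  have shift: "(\<lambda>n. norm (e (n + j))) \<in> o(\<lambda>n. norm (d r n))" for j
  proof -
    have "filterlim (\<lambda>n. n + j) at_top sequentially"
      by (rule filterlim_add_const_nat_at_top)
    with e_d have "(\<lambda>n. norm (e (n + j))) \<in> o(\<lambda>n. norm (d r (n + j)))"
      by (rule landau_o.small.compose)
    also have "(\<lambda>n. norm (d r (n + j))) \<in> O(\<lambda>n. norm (d r n))"
      using bigoI_tendsto[OF d_shift[OF r] d_nonzero[OF r]] by simp
    finally show ?thesis .
  qed
  have "(\<lambda>n. ip y (fdiff e (n + j)) / d r n) \<longlonglongrightarrow> 0" for j
  proof (rule smalloD_tendsto)
    have "(\<lambda>n. norm (ip y (fdiff e (n + j)))) \<in> O(\<lambda>n. norm (e (n + Suc j)) + norm (e (n + j)))"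
    proof (rule bigoI[of _ "norm y"], rule always_eventually, rule allI)
      fix n
      have "norm (ip y (fdiff e (n + j))) \<le> norm y * norm (fdiff e (n + j))"
        by (rule cauchy_schwarz)
      also have "\<dots> \<le> norm y * (norm (e (n + Suc j)) + norm (e (n + j)))"
        by (intro mult_left_mono) (auto simp: fdiff_def norm_triangle_ineq4)
      finally show "norm (norm (ip y (fdiff e (n + j)))) \<le>
          norm y * norm (norm (e (n + Suc j)) + norm (e (n + j)))"
        by simp
    qed
    also have "(\<lambda>n. norm (e (n + Suc j)) + norm (e (n + j))) \<in> o(\<lambda>n. norm (d r n))"
      by (intro sum_in_smallo shift)
    finally show "(\<lambda>n. ip y (fdiff e (n + j))) \<in> o(d r)"
      by simp
  qed
  moreover have "(\<lambda>n. scale (1 / d r n) (e n)) \<longlonglongrightarrow> 0"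
  proof (rule tendsto_norm_zero_cancel)
    have "norm (scale (1 / d r n) (e n)) = norm (e n) / norm (d r n)" for n
      by (simp add: norm_scale norm_divide)
    then show "(\<lambda>n. norm (scale (1 / d r n) (e n))) \<longlonglongrightarrow> 0"
      using smalloD_tendsto[OF e_d] by (simp only:)
  qed
  \<comment> \<open>All of row 0 has limit 0, hence so does the determinant.\<close>
  ultimately have "(\<lambda>n. scale (1 / d r n) (f n k e)) \<longlonglongrightarrow>
      scale (1 / vandermonde b k) (vdet scale k (ghat(0 := 0)) (\<lambda>p j. if p = 0 then 0 else b p ^ j))"
    by (intro fnk_tendsto)
  then have "(\<lambda>n. scale (1 / d r n) (f n k e)) \<longlonglongrightarrow> 0"
    by (simp add: vdet_zero_row)
  from tendsto_norm_zero[OF this] have "(\<lambda>n. norm (f n k e) / norm (d r n)) \<longlonglongrightarrow> 0"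
    by (simp add: norm_scale norm_divide)
  then have "(\<lambda>n. norm (f n k e)) \<in> o(\<lambda>n. norm (d r n))"
    by (rule smalloI_tendsto) (use d_nonzero[OF r] in auto)
  also have "(\<lambda>n. norm (d r n)) \<in> O(\<lambda>n. norm (g r n))"
    using norm_g_theta_d[OF r] by (auto dest: bigthetaD2 simp: bigomega_iff_bigo)
  finally show ?thesis .
qed

text \<open>The factor \<open>d i n\<close> cancels in the quotient of two normalized limits. A
  vanishing \<open>hhat\<close> is included, with limit 0.\<close>

lemma norm_fnk_g_tendsto:
  assumes "1 \<le> i"
  shows "(\<lambda>n. norm (f n k (g i)) / norm (g i n)) \<longlonglongrightarrow> C k i"
proof -
  have "(\<lambda>n. norm (scale (1 / d i n) (f n k (g i))) / norm (scale (1 / d i n) (g i n)))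
      \<longlonglongrightarrow> norm (scale (1 / vandermonde b k) (hhat scale ghat b k i)) / norm (ghat i)"
    by (intro tendsto_divide tendsto_norm fnk_g_tendsto ghat_lim assms) (use ghat_nonzero assms in auto)
  moreover have "eventually (\<lambda>n. norm (scale (1 / d i n) (f n k (g i))) / norm (scale (1 / d i n) (g i n)) =
      norm (f n k (g i)) / norm (g i n)) sequentially"
    using d_nonzero[OF assms] by eventually_elim (simp add: norm_scale norm_divide)
  ultimately have "(\<lambda>n. norm (f n k (g i)) / norm (g i n)) \<longlonglongrightarrow>
      norm (scale (1 / vandermonde b k) (hhat scale ghat b k i)) / norm (ghat i)"
    by (rule Lim_transform_eventually)
  then show ?thesis
    by (simp add: norm_scale norm_divide)
qed

lemma C_nonzero: "1 \<le> i \<Longrightarrow> hhat scale ghat b k i \<noteq> 0 \<Longrightarrow> C k i \<noteq> 0"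
  using vandermonde_b_nonzero ghat_nonzero by simp

lemma norm_fnk_g_asymp_equiv:
  assumes "1 \<le> i" "hhat scale ghat b k i \<noteq> 0"
  shows "(\<lambda>n. norm (f n k (g i))) \<sim>[sequentially] (\<lambda>n. C k i * norm (g i n))"
proof (rule asymp_equivI')
  have "(\<lambda>n. norm (f n k (g i)) / norm (g i n) / C k i) \<longlonglongrightarrow> C k i / C k i"
    by (intro tendsto_divide tendsto_const norm_fnk_g_tendsto assms C_nonzero)
  then show "(\<lambda>n. norm (f n k (g i)) / (C k i * norm (g i n))) \<longlonglongrightarrow> 1"
    using divide_self[OF C_nonzero[OF assms]]
    by (simp only: divide_divide_eq_left mult.commute[of "C k i"])
qed

lemma norm_fnk_g_bigo:
  assumes "1 \<le> i"
  shows "(\<lambda>n. norm (f n k (g i))) \<in> O(\<lambda>n. norm (g i n))"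
  by (rule bigoI_tendsto[OF norm_fnk_g_tendsto]) (use assms g_nonzero in auto)

text \<open>Lower bound from \<open>C k i\<close> being nonzero; it turns errors
  \<open>o(g i)\<close> into errors relative to the extrapolated term.\<close>

lemma norm_g_bigo_fnk_g:
  assumes "1 \<le> i" "hhat scale ghat b k i \<noteq> 0"
  shows "(\<lambda>n. norm (g i n)) \<in> O(\<lambda>n. norm (f n k (g i)))"
proof -
  have "(\<lambda>n. norm (f n k (g i))) \<in> \<Omega>(\<lambda>n. norm (g i n))"
    by (rule bigomegaI_tendsto[OF C_nonzero[OF assms] norm_fnk_g_tendsto]) fact
  then show ?thesis by (simp add: bigomega_iff_bigo)
qed

end

section \<open>Asymptotics of the extrapolated sequence\<close>

locale extrapolation = extrapolation_scale scale ip y g ghat b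
  for scale :: "'k::rc_field \<Rightarrow> 'v::real_normed_vector \<Rightarrow> 'v" and ip y g ghat b +
  fixes x :: "nat \<Rightarrow> 'v" and s :: 'v and \<alpha> :: "nat \<Rightarrow> 'k"
  assumes x_expansion: "r \<ge> 1 \<Longrightarrow>
    (\<lambda>m. norm (x m - s - (\<Sum>i=1..r. scale (\<alpha> i) (g i m)))) \<in> o(\<lambda>m. norm (g r m))"
begin

text \<open>The extrapolation error is eventually the image of the remainder, to which
  \<open>fnk_smallo\<close> applies. The case of \<open>r\<close> at most \<open>k\<close>, with
  empty sum, is used in \<open>fnk_x_bigo\<close>.\<close>

lemma fnk_x_expansion:
  assumes "1 \<le> r"
  shows "(\<lambda>n. norm (f n k x - s - (\<Sum>i=k+1..r. scale (\<alpha> i) (f n k (g i))))) \<in> o(\<lambda>n. norm (g r n))"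
proof -
  have "eventually (\<lambda>n. norm (f n k x - s - (\<Sum>i=k+1..r. scale (\<alpha> i) (f n k (g i)))) =
      norm (f n k (\<lambda>m. x m - s - (\<Sum>i=1..r. scale (\<alpha> i) (g i m))))) sequentially"
    using Dnk_nonzero[of k] by eventually_elim (rule arg_cong[OF fnk_expansion])
  then show ?thesis
    using fnk_smallo[OF assms x_expansion[OF assms], of k] by (subst landau_o.small.in_cong)
qed

lemma fnk_x_first_term:
  assumes "k < M" "\<And>i. k < i \<Longrightarrow> i < M \<Longrightarrow> \<alpha> i = 0"
  shows "(\<lambda>n. norm (f n k x - s - scale (\<alpha> M) (f n k (g M)))) \<in> o(\<lambda>n. norm (g M n))"
proof -
  have "(\<Sum>i=k+1..M. scale (\<alpha> i) (f n k (g i))) = (\<Sum>i\<in>{M}. scale (\<alpha> i) (f n k (g i)))" for n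
    by (rule sum.mono_neutral_right) (use assms in auto)
  then show ?thesis
    using fnk_x_expansion[of M k] assms by simp
qed

text \<open>If \<open>k < M\<close>, the leading term is \<open>O(g M)\<close> and the rest is
  smaller. Otherwise \<open>g M\<close> itself is annihilated and the error is even
  \<open>o(g M)\<close>.\<close>

lemma fnk_x_bigo:
  assumes "1 \<le> M" "\<And>i. k < i \<Longrightarrow> i < M \<Longrightarrow> \<alpha> i = 0"
  shows "(\<lambda>n. norm (f n k x - s)) \<in> O(\<lambda>n. norm (g M n))"
proof (cases "k < M")
  case False
  then show ?thesis
    using fnk_x_expansion[OF assms(1), of k] by (auto intro: landau_o.small_imp_big)
next
  case True
  have "(\<lambda>n. norm (f n k x - s)) \<in>
      O(\<lambda>n. norm (f n k x - s - scale (\<alpha> M) (f n k (g M))) + norm (scale (\<alpha> M) (f n k (g M))))"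
  proof (rule bigoI[of _ 1], rule always_eventually, rule allI)
    fix n
    show "norm (norm (f n k x - s)) \<le> 1 * norm (norm (f n k x - s - scale (\<alpha> M) (f n k (g M))) +
        norm (scale (\<alpha> M) (f n k (g M))))"
      using norm_triangle_ineq[of "f n k x - s - scale (\<alpha> M) (f n k (g M))" "scale (\<alpha> M) (f n k (g M))"]
      by simp
  qed
  also have "(\<lambda>n. norm (f n k x - s - scale (\<alpha> M) (f n k (g M))) + norm (scale (\<alpha> M) (f n k (g M)))) \<in>
      O(\<lambda>n. norm (g M n))"
    using landau_o.small_imp_big[OF fnk_x_first_term[OF True]] norm_fnk_g_bigo[OF assms(1), of k] assms
    by (intro sum_in_bigo) (auto simp: norm_scale)
  finally show ?thesis .
qed

lemma fnk_x_asymp_equiv: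
  assumes "k < M" "\<And>i. k < i \<Longrightarrow> i < M \<Longrightarrow> \<alpha> i = 0"
    and "\<alpha> M \<noteq> 0" "hhat scale ghat b k M \<noteq> 0"
  shows "vec_asymp_equiv (\<lambda>n. f n k x - s) (\<lambda>n. scale (\<alpha> M) (f n k (g M)))"
  unfolding vec_asymp_equiv_def norm_scale
  using landau_o.small_big_trans[OF fnk_x_first_term[OF assms(1,2)] norm_g_bigo_fnk_g[OF _ assms(4)]] assms
  by simp

lemma norm_fnk_x_asymp_equiv:
  assumes "k < M" "\<And>i. k < i \<Longrightarrow> i < M \<Longrightarrow> \<alpha> i = 0"
    and "\<alpha> M \<noteq> 0" "hhat scale ghat b k M \<noteq> 0"
  shows "(\<lambda>n. norm (f n k x - s)) \<sim>[sequentially] (\<lambda>n. norm (\<alpha> M) * C k M * norm (g M n))"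
proof -
  have "(\<lambda>n. norm (f n k x - s)) \<sim>[sequentially] (\<lambda>n. norm (\<alpha> M) * norm (f n k (g M)))"
    using vec_asymp_equiv_norm[OF fnk_x_asymp_equiv[OF assms]] by (simp add: norm_scale)
  also have "\<dots> \<sim>[sequentially] (\<lambda>n. norm (\<alpha> M) * (C k M * norm (g M n)))"
    by (intro asymp_equiv_mult asymp_equiv_refl norm_fnk_g_asymp_equiv) (use assms in auto)
  finally show ?thesis by (simp only: mult.assoc)
qed

text \<open>Lower bound on the error, needed when it stands in a denominator.\<close>

lemma norm_g_bigo_fnk_x:
  assumes "k < M" "\<And>i. k < i \<Longrightarrow> i < M \<Longrightarrow> \<alpha> i = 0"
    and "\<alpha> M \<noteq> 0" "hhat scale ghat b k M \<noteq> 0"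
  shows "(\<lambda>n. norm (g M n)) \<in> O(\<lambda>n. norm (f n k x - s))"
proof -
  define c where "c = norm (\<alpha> M) * C k M"
  have "1 \<le> M" "norm (\<alpha> M) \<noteq> 0"
    using assms(1,3) by simp_all
  moreover from \<open>1 \<le> M\<close> have "C k M \<noteq> 0"
    using assms(4) by (rule C_nonzero)
  ultimately have "c \<noteq> 0"
    unfolding c_def by (simp only: mult_eq_0_iff simp_thms)
  then have "(\<lambda>n. norm (g M n)) \<in> O(\<lambda>n. c * norm (g M n))"
    by (intro bigoI[of _ "1 / norm c"]) (simp add: abs_mult)
  also have "(\<lambda>n. c * norm (g M n)) \<in> O(\<lambda>n. norm (f n k x - s))"
    unfolding c_def
    by (rule asymp_equiv_imp_bigo[OF asymp_equiv_symI[OF norm_fnk_x_asymp_equiv[OF assms]]])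
  finally show ?thesis .
qed

text \<open>Where \<open>g M n\<close> is nonzero, the lower bound excludes a zero error.\<close>

lemma fnk_x_ne_limit:
  assumes "k < M" "\<And>i. k < i \<Longrightarrow> i < M \<Longrightarrow> \<alpha> i = 0"
    and "\<alpha> M \<noteq> 0" "hhat scale ghat b k M \<noteq> 0"
  shows "eventually (\<lambda>n. f n k x \<noteq> s) sequentially"
proof -
  obtain c where "eventually (\<lambda>n. norm (norm (g M n)) \<le> c * norm (norm (f n k x - s))) sequentially"
    using landau_o.bigE[OF norm_g_bigo_fnk_x[OF assms]] by blast
  moreover have "eventually (\<lambda>n. g M n \<noteq> 0) sequentially"
    using assms by (intro g_nonzero) auto
  ultimately show ?thesis
    by eventually_elim auto
qed

lemma fnk_x_quotient_bigo:
  assumes "k < M" "\<And>i. k < i \<Longrightarrow> i < M \<Longrightarrow> \<alpha> i = 0"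
    and "\<alpha> M \<noteq> 0" "hhat scale ghat b k M \<noteq> 0"
    and "1 \<le> M'" "\<And>i. k' < i \<Longrightarrow> i < M' \<Longrightarrow> \<alpha> i = 0"
  shows "(\<lambda>n. norm (f n k' x - s) / norm (f n k x - s)) \<in> O(\<lambda>n. norm (g M' n) / norm (g M n))"
  by (rule landau_o.big.divide)
     (use fnk_x_ne_limit[OF assms(1-4)] g_nonzero[of M] fnk_x_bigo[OF assms(5,6)]
       norm_g_bigo_fnk_x[OF assms(1-4)] assms in auto)

end

theorem theorem1:
  fixes scale :: "'k::rc_field \<Rightarrow> 'v::real_normed_vector \<Rightarrow> 'v"
    and ip :: "'v \<Rightarrow> 'v \<Rightarrow> 'k"
    and y s :: 'v
    and x :: "nat \<Rightarrow> 'v"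
    and g :: "nat \<Rightarrow> nat \<Rightarrow> 'v"
    and ghat :: "nat \<Rightarrow> 'v"
    and \<alpha> b :: "nat \<Rightarrow> 'k"
    and k :: nat
  defines "D \<equiv> Dnk ip y g"
    and "f \<equiv> fnk scale ip y g"
    and "S \<equiv> (\<lambda>n k. fnk scale ip y g n k x)"
    and "h \<equiv> hhat scale ghat b"
    and "V \<equiv> vandermonde b"
    and "C \<equiv> (\<lambda>k i. 1 / norm (vandermonde b k) * (norm (hhat scale ghat b k i) / norm (ghat i)))"
  assumes "inner_product_space scale ip"
    and "y \<noteq> 0"
    and "\<forall>i\<ge>1. (\<lambda>m. norm (g (Suc i) m) / norm (g i m)) \<longlonglongrightarrow> 0"
    and "\<forall>r\<ge>1. (\<lambda>m. norm (x m - s - (\<Sum>i=1..r. scale (\<alpha> i) (g i m)))) \<in> o(\<lambda>m. norm (g r m))"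
    and "\<forall>i\<ge>1. (\<lambda>m. ip y (g i (Suc m)) / ip y (g i m)) \<longlonglongrightarrow> b i"
    and "\<forall>i\<ge>1. b i \<noteq> 1"
    and "inj_on b {1..}"
    and "\<forall>i\<ge>1. norm (b i) > norm (b (Suc i))"
    and "b \<longlonglongrightarrow> 0"
    and "\<forall>i\<ge>1. (\<lambda>m. scale (1 / ip y (fdiff (g i) m)) (g i m)) \<longlonglongrightarrow> ghat i"
    and "\<forall>i\<ge>1. ghat i \<noteq> 0"
    and "k \<ge> 1"
  shows
    \<comment> \<open>1\<close>
    "(\<forall>i\<ge>1.
        (\<lambda>m. ip y (fdiff (g i) (Suc m)) / ip y (fdiff (g i) m)) \<longlonglongrightarrow> b i \<and>
        (\<lambda>m. ip y (fdiff (g (Suc i)) m) / ip y (fdiff (g i) m)) \<longlonglongrightarrow> 0) \<and>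
    \<comment> \<open>2\<close>
     (\<exists>n0>0. \<forall>n\<ge>n0. D n k \<noteq> 0) \<and>
    \<comment> \<open>3 (a)\<close>
     (\<forall>i\<in>{1..k}. \<forall>n. D n k \<noteq> 0 \<longrightarrow> f n k (g i) = 0) \<and>
     (\<forall>i\<ge>k+1.
        (h k i \<noteq> 0 \<longrightarrow>
           vec_asymp_equiv (\<lambda>n. scale (1 / ip y (fdiff (g i) n)) (f n k (g i)))
                           (\<lambda>n. scale (1 / V k) (h k i))) \<and>
        (h k i = 0 \<longrightarrow>
           (\<lambda>n. norm (scale (1 / ip y (fdiff (g i) n)) (f n k (g i)))) \<longlonglongrightarrow> 0) \<and>
        (h k i \<noteq> 0 \<longrightarrow>
           asymp_equiv (\<lambda>n. norm (f n k (g i))) sequentially (\<lambda>n. C k i * norm (g i n))) \<and>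
        (h k i = 0 \<longrightarrow>
           (\<lambda>n. norm (f n k (g i))) \<in> o(\<lambda>n. norm (g i n)))) \<and>
    \<comment> \<open>3 (b)\<close>
     (\<forall>i\<ge>k+1. (\<lambda>n. norm (f n k (g (Suc i))) / norm (g i n)) \<longlonglongrightarrow> 0) \<and>
    \<comment> \<open>4\<close>
     (\<forall>r\<ge>k+1.
        (\<lambda>n. norm (S n k - s - (\<Sum>i=k+1..r. scale (\<alpha> i) (f n k (g i)))))
          \<in> o(\<lambda>n. norm (g r n)) \<and>
        (h k r \<noteq> 0 \<longrightarrow>
           (\<lambda>n. norm (S n k - s - (\<Sum>i=k+1..r. scale (\<alpha> i) (f n k (g i)))))
             \<in> o(\<lambda>n. norm (f n k (g r))))) \<and>
    \<comment> \<open>5\<close>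
     (\<forall>\<mu>\<ge>1. \<alpha> (k+\<mu>) \<noteq> 0 \<and> (\<forall>i. 1 \<le> i \<and> i < \<mu> \<longrightarrow> \<alpha> (k+i) = 0) \<longrightarrow>
        \<comment> \<open>(a)\<close>
        (\<lambda>n. norm (S n k - s)) \<in> O(\<lambda>n. norm (g (k+\<mu>) n)) \<and>
        (\<forall>j\<in>{0..k+\<mu>-1}. (\<lambda>n. norm (S n (k+j) - s)) \<in> O(\<lambda>n. norm (g (k+\<mu>) n))) \<and>
        \<comment> \<open>(b)\<close>
        (h k (k+\<mu>) \<noteq> 0 \<longrightarrow>
           vec_asymp_equiv (\<lambda>n. S n k - s) (\<lambda>n. scale (\<alpha> (k+\<mu>)) (f n k (g (k+\<mu>))))) \<and>
        ((\<forall>j\<in>{0..\<mu>-1}. h (k+j) (k+\<mu>) \<noteq> 0) \<longrightarrow>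
           (\<forall>j\<in>{0..\<mu>-1}.
              vec_asymp_equiv (\<lambda>n. S n (k+j) - s)
                              (\<lambda>n. scale (\<alpha> (k+\<mu>)) (f n (k+j) (g (k+\<mu>)))) \<and>
              asymp_equiv (\<lambda>n. norm (S n (k+j) - s)) sequentially
                          (\<lambda>n. norm (\<alpha> (k+\<mu>)) * C (k+j) (k+\<mu>) * norm (g (k+\<mu>) n)))) \<and>
        \<comment> \<open>(c)\<close>
        (\<alpha> k \<noteq> 0 \<and> h (k-1) k \<noteq> 0 \<longrightarrow>
           (\<forall>\<^sub>F n in sequentially. S n (k-1) \<noteq> s) \<and>
           (\<lambda>n. norm (g (k+\<mu>) n) / norm (g k n)) \<in> o(\<lambda>_. 1) \<and>
           (\<forall>j\<in>{0..k+\<mu>-1}.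
              (\<lambda>n. norm (S n (k+j) - s) / norm (S n (k-1) - s))
                \<in> O(\<lambda>n. norm (g (k+\<mu>) n) / norm (g k n)) \<and>
              (\<lambda>n. norm (S n (k+j) - s) / norm (S n (k-1) - s)) \<in> o(\<lambda>_. 1))))"
proof -
  interpret E: extrapolation scale ip y g ghat b x s \<alpha>
    by (intro extrapolation.intro extrapolation_scale.intro extrapolation_scale_axioms.intro
        extrapolation_axioms.intro) (use assms in auto)
  \<comment> \<open>Rewrites the vanishing condition in terms of the absolute index
    \<open>i = k + (i - k)\<close>.\<close>
  have gap: "\<alpha> i = 0"
    if "\<alpha> (k+\<mu>) \<noteq> 0 \<and> (\<forall>i. 1 \<le> i \<and> i < \<mu> \<longrightarrow> \<alpha> (k+i) = 0)" "k < i" "i < k+\<mu>" for i \<mu>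
    using that(1)[THEN conjunct2, rule_format, of "i - k"] that(2,3) by fastforce
  show ?thesis
  proof (intro conjI allI impI ballI, goal_cases)
    case (1 i)
    then show ?case by (rule E.d_ratio)
  next
    case (2 i)
    then show ?case by (intro smalloD_tendsto E.d_smallo)
  next
    case 3
    \<comment> \<open>\<open>n0\<close> must be positive, so the threshold is raised by one. It
      depends only on the denominator, hence not on the sequence.\<close>
    show ?case
      using E.Dnk_nonzero[of k] unfolding D_def eventually_sequentially
      by (metis le_trans le_add1 zero_less_Suc Suc_eq_plus1 linorder_le_cases)
  next
    case (4 i n)
    then show ?case unfolding f_def by (intro E.fnk_g_eq_0)
  next
    case (5 i)
    then have "1 \<le> i" by simp
    from E.fnk_g_tendsto[OF this, of k] 5 show ?case
      unfolding f_def V_def h_def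
      by (intro vec_asymp_equiv_const) (simp_all add: E.vandermonde_b_nonzero)
  next
    case (6 i)
    then have "1 \<le> i" by simp
    from tendsto_norm[OF E.fnk_g_tendsto[OF this, of k]] 6 show ?case
      unfolding f_def V_def h_def by simp
  next
    case (7 i)
    then have "1 \<le> i" by simp
    from E.norm_fnk_g_asymp_equiv[OF this, of k] 7 show ?case
      unfolding f_def C_def h_def by simp
  next
    case (8 i)
    then have "1 \<le> i" by simp
    \<comment> \<open>Here \<open>C k i\<close> is 0, so the quotient of norms tends to 0.\<close>
    from E.norm_fnk_g_tendsto[OF this, of k] E.g_nonzero[OF this] 8 show ?case
      unfolding f_def h_def by (intro smalloI_tendsto) auto
  next
    case (9 i)
    have "(\<lambda>n. norm (f n k (g (Suc i)))) \<in> O(\<lambda>n. norm (g (Suc i) n))"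
      unfolding f_def by (rule E.norm_fnk_g_bigo) simp
    also have "(\<lambda>n. norm (g (Suc i) n)) \<in> o(\<lambda>n. norm (g i n))"
      using 9 by (intro E.g_smallo) auto
    finally show ?case by (rule smalloD_tendsto)
  next
    case (10 r)
    then show ?case
      unfolding S_def f_def by (intro E.fnk_x_expansion) simp
  next
    case (11 r)
    have "(\<lambda>n. norm (S n k - s - (\<Sum>i=k+1..r. scale (\<alpha> i) (f n k (g i))))) \<in> o(\<lambda>n. norm (g r n))"
      unfolding S_def f_def using 11 by (intro E.fnk_x_expansion) simp
    also have "(\<lambda>n. norm (g r n)) \<in> O(\<lambda>n. norm (f n k (g r)))"
      using 11 unfolding f_def h_def by (intro E.norm_g_bigo_fnk_g) auto
    finally show ?case .
  next
    case (12 \<mu>)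
    then have "\<alpha> i = 0" if "k < i" "i < k + \<mu>" for i
      using that by (auto intro: gap)
    with 12 show ?case
      unfolding S_def by (intro E.fnk_x_bigo) auto
  next
    case (13 \<mu> j)
    \<comment> \<open>The vanishing coefficients above \<open>k\<close> include those above
      \<open>k + j\<close>; for \<open>j \<ge> \<mu>\<close> there are none to check.\<close>
    then have "\<alpha> i = 0" if "k < i" "i < k + \<mu>" for i
      using that by (auto intro: gap)
    with 13 show ?case
      unfolding S_def by (intro E.fnk_x_bigo) auto
  next
    case (14 \<mu>)
    then have "\<alpha> i = 0" if "k < i" "i < k + \<mu>" for i
      using that by (auto intro: gap)
    with 14 show ?case
      unfolding S_def f_def h_def by (intro E.fnk_x_asymp_equiv) auto
  next
    case (15 \<mu> j)
    then have "\<alpha> i = 0" if "k < i" "i < k + \<mu>" for i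
      using that by (auto intro: gap)
    moreover have "k + j < k + \<mu>" using 15 by auto
    ultimately show ?case
      using 15 unfolding S_def f_def h_def by (intro E.fnk_x_asymp_equiv) auto
  next
    case (16 \<mu> j)
    then have "\<alpha> i = 0" if "k < i" "i < k + \<mu>" for i
      using that by (auto intro: gap)
    moreover have "k + j < k + \<mu>" using 16 by auto
    ultimately show ?case
      using 16 unfolding S_def C_def h_def by (intro E.norm_fnk_x_asymp_equiv) auto
  next
    case (17 \<mu>)
    then show ?case
      \<comment> \<open>With \<open>k - 1\<close> extrapolated terms the first remaining index is
        \<open>k\<close>, so no coefficients lie in between.\<close>
      using \<open>1 \<le> k\<close> unfolding S_def h_def by (intro E.fnk_x_ne_limit[of _ k]) auto
  next
    case (18 \<mu>)
    then show ?case
      using \<open>1 \<le> k\<close> smalloD_tendsto[OF E.g_smallo[of k "k + \<mu>"]]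
      by (intro smalloI_tendsto) auto
  next
    case (19 \<mu> j)
    then have "\<alpha> i = 0" if "k < i" "i < k + \<mu>" for i
      using that by (auto intro: gap)
    with 19 show ?case
      \<comment> \<open>The numerator has leading index \<open>k + \<mu>\<close>, the denominator
        leading index \<open>k\<close>.\<close>
      using \<open>1 \<le> k\<close> unfolding S_def h_def by (intro E.fnk_x_quotient_bigo) auto
  next
    case (20 \<mu> j)
    then have "\<alpha> i = 0" if "k < i" "i < k + \<mu>" for i
      using that by (auto intro: gap)
    with 20 have "(\<lambda>n. norm (S n (k+j) - s) / norm (S n (k-1) - s))
        \<in> O(\<lambda>n. norm (g (k+\<mu>) n) / norm (g k n))"
      using \<open>1 \<le> k\<close> unfolding S_def h_def by (intro E.fnk_x_quotient_bigo) auto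
    also have "(\<lambda>n. norm (g (k+\<mu>) n) / norm (g k n)) \<in> o(\<lambda>_. 1)"
      using 20 \<open>1 \<le> k\<close> smalloD_tendsto[OF E.g_smallo[of k "k + \<mu>"]]
      by (intro smalloI_tendsto) auto
    finally show ?case .
  qed
qed

end
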